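(* Let $\eta,\zeta: I\subset[0,\infty)\to[0,\infty)$ be prescribed continuously differentiable functions, with the additional hypothesis on $\eta$ that the function $f_\eta: t\in I\mapsto t\exp[-2\eta(t)]\in[0,\infty)$ be invertible with inverse $g_\eta$. Consider, for $k$-forms $\omega$ on $\Omega$, the nonlinear Hodge–Frobenius system $$d*\big(\rho\,\omega\big)=\Sigma\wedge *\big(\rho\,\omega\big),\qquad d\omega=\Gamma\wedge\omega,\qquad (\ast)$$ in which the terms $\Sigma$, $\Gamma$ and the mass density $\rho$ are prescribed by $$\Sigma=d\big[\zeta(|\omega|^2)\big],\qquad \Gamma=d\big[\eta(|\omega|^2)\big],\qquad \rho=\rho_1(x,|\omega|^2),\qquad\text{for } |\omega|^2\in I.$$ Then for every classical solution $\omega_1$ of system $(\ast)$ there is a classical solution $\omega_0$ of the conventional nonlinear Hodge equations $$\delta(\rho\,\omega)=0,\qquad d\omega=0,\qquad (\ast\ast)$$ with mass density $\rho=\rho_0(x,|\omega_0|^2)$, where $\rho_0$ depends on $\rho_1$, $\eta$ and $\zeta$, and $\omega_0$ is related to $\omega_1$ by $C^1$ conformal transformations. The ellipticity condition for system $(\ast\ast)$ holds if and only if $g_\eta'$ and $\partial_t\phi_{\rho_1e^{-\zeta}}$ have the same sign. The converse also holds.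
   Context: $\Omega$ is a smooth open domain in $\mathbb{R}^n$; $d$ is the exterior derivative, $\delta$ its formal adjoint, $*$ the Hodge duality operator, and $|\omega|^2=*(\omega\wedge*\omega)$. Mass densities are positive functions. For a density $\rho(x,t)$ put $\phi_\rho(x,t)=t\,\rho^2(x,t)$; thus $\phi_{\rho_1e^{-\zeta}}(x,t)=t\,\rho_1^2(x,t)\,e^{-2\zeta(t)}$. The ellipticity condition for the nonlinear Hodge equations with density $\rho(x,Q)$, $Q=|\omega|^2$, is $0<\rho^2+2Q\rho'\rho$, where the prime is the derivative in $Q$; equivalently $\partial_Q\phi_\rho(x,Q)>0$.
   Formalization: The converse is proved assuming the inverse g_η is continuously differentiable, without which it fails when f_η has a critical point; the ellipticity equivalence is stated pointwise where g_η and ρ_1 (in t) are differentiable. *)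

theory Defs
  imports "HOL-Analysis.Analysis"
begin

section \<open>Functions of class C^k\<close>

text \<open>On an open subset of a Euclidean space this is the usual notion: all iterated directional
  derivatives of order at most \<open>m\<close> exist and are continuous.\<close>

primrec Ck_on :: "nat \<Rightarrow> 'a::real_normed_vector set \<Rightarrow> ('a \<Rightarrow> 'b::real_normed_vector) \<Rightarrow> bool" where
  "Ck_on 0 S f \<longleftrightarrow> continuous_on S f"
| "Ck_on (Suc m) S f \<longleftrightarrow>
     (\<forall>x\<in>S. f differentiable (at x)) \<and> (\<forall>v. Ck_on m S (\<lambda>x. frechet_derivative f (at x) v))"

text \<open>Intervals may contain end points, at which the derivative is one-sided; values outside the
  interval are irrelevant. This is why \<open>C1_differentiable_on\<close> is not used.\<close>

definition C1_on_interval :: "real set \<Rightarrow> (real \<Rightarrow> real) \<Rightarrow> bool" where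
  "C1_on_interval I h \<longleftrightarrow>
     (\<exists>h'. continuous_on I h' \<and> (\<forall>t\<in>I. (h has_real_derivative h' t) (at t within I)))"

text \<open>A domain (nonempty, open, connected) that near each of its boundary points is a sublevel set
  of a smooth function without critical points.\<close>

definition smooth_domain :: "(real^'n) set \<Rightarrow> bool" where
  "smooth_domain \<Omega> \<longleftrightarrow> open \<Omega> \<and> connected \<Omega> \<and> \<Omega> \<noteq> {} \<and>
     (\<forall>p\<in>frontier \<Omega>. \<exists>U r. open U \<and> p \<in> U \<and> (\<forall>m. Ck_on m U (r :: real^'n \<Rightarrow> real)) \<and>
        (\<forall>x\<in>U. \<exists>v. frechet_derivative r (at x) v \<noteq> 0) \<and> \<Omega> \<inter> U = {x\<in>U. r x < 0})"

section \<open>Differential forms\<close>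

text \<open>The exterior algebra of the dual of \<open>real^'n\<close> is \<open>real^('n set)\<close>: the coordinate at
  \<open>K = {i\<^sub>1 < \<dots> < i\<^sub>p}\<close> is the coefficient of \<open>dx\<^sub>K = dx\<^sub>i\<^sub>1 \<and> \<dots> \<and> dx\<^sub>i\<^sub>p\<close>.
  The order of \<open>'n\<close> fixes this basis and the orientation. Functions are 0-forms via \<open>form0\<close>.\<close>

type_synonym 'n point = "(real, 'n) vec"
type_synonym 'n multicovector = "(real, 'n set) vec"
type_synonym 'n form = "'n point \<Rightarrow> 'n multicovector"

text \<open>\<open>dx\<^sub>I \<and> dx\<^sub>J = shuffle_sign I J dx\<^bsub>I \<union> J\<^esub>\<close> for disjoint \<open>I\<close> and \<open>J\<close>.\<close>

definition shuffle_sign :: "'n::linorder set \<Rightarrow> 'n set \<Rightarrow> real" where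
  "shuffle_sign I J = (-1) ^ card {(i, j). i \<in> I \<and> j \<in> J \<and> j < i}"

definition wedge ::
  "('n::{finite,linorder}) multicovector \<Rightarrow> 'n multicovector \<Rightarrow> 'n multicovector" (infixr "\<and>\<^sub>f" 70) where
  "a \<and>\<^sub>f b = (\<chi> K. \<Sum>I\<in>Pow K. shuffle_sign I (K - I) * a $ I * b $ (K - I))"

text \<open>\<open>*dx\<^sub>I = shuffle_sign I (- I) dx\<^bsub>- I\<^esub>\<close>, so that \<open>dx\<^sub>I \<and> *dx\<^sub>I\<close> is the volume form.\<close>

definition hodge :: "('n::{finite,linorder}) multicovector \<Rightarrow> 'n multicovector" where
  "hodge a = (\<chi> K. shuffle_sign (- K) K * a $ (- K))"

definition form0 :: "real \<Rightarrow> ('n::{finite,linorder}) multicovector" where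
  "form0 c = axis {} c"

definition normsq :: "('n::{finite,linorder}) multicovector \<Rightarrow> real" where
  "normsq a = hodge (a \<and>\<^sub>f hodge a) $ {}"

definition k_form :: "nat \<Rightarrow> (('n::{finite,linorder}) point) set \<Rightarrow> 'n form \<Rightarrow> bool" where
  "k_form k \<Omega> \<omega> \<longleftrightarrow> (\<forall>x\<in>\<Omega>. \<forall>K. card K \<noteq> k \<longrightarrow> \<omega> x $ K = 0)"

text \<open>\<open>d\<omega> = \<Sum>\<^sub>i dx\<^sub>i \<and> \<partial>\<^sub>i\<omega>\<close>.\<close>

definition ext_deriv ::
  "('n::{finite,linorder}) form \<Rightarrow> 'n point \<Rightarrow> 'n multicovector" where
  "ext_deriv \<omega> x = (\<Sum>i\<in>UNIV. axis {i} 1 \<and>\<^sub>f frechet_derivative \<omega> (at x) (axis i 1))"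

text \<open>The formal adjoint of \<open>d\<close> on \<open>k\<close>-forms, \<open>\<delta> = (-1)\<^bsup>n(k+1)+1\<^esup> * d *\<close>. The sign makes
  \<open>(\<langle>d\<alpha>, \<beta>\<rangle> - \<langle>\<alpha>, \<delta>\<beta>\<rangle>) vol = d(\<alpha> \<and> *\<beta>)\<close> for \<open>(k-1)\<close>-forms \<open>\<alpha>\<close> and \<open>k\<close>-forms \<open>\<beta>\<close>.\<close>

definition codiff ::
  "nat \<Rightarrow> ('n::{finite,linorder}) form \<Rightarrow> 'n point \<Rightarrow> 'n multicovector" where
  "codiff k \<omega> x =
     (-1) ^ (CARD('n) * (k + 1) + 1) *\<^sub>R hodge (ext_deriv (\<lambda>y. hodge (\<omega> y)) x)"

section \<open>Mass densities and the nonlinear Hodge systems\<close>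

definition mass_density :: "(('n::{finite,linorder}) point) set \<Rightarrow> real set \<Rightarrow> ('n point \<Rightarrow> real \<Rightarrow> real) \<Rightarrow> bool" where
  "mass_density \<Omega> I \<rho> \<longleftrightarrow> (\<forall>x\<in>\<Omega>. \<forall>Q\<in>I. 0 < \<rho> x Q)"

definition weighted ::
  "(('n::{finite,linorder}) point \<Rightarrow> real \<Rightarrow> real) \<Rightarrow> 'n form \<Rightarrow> 'n point \<Rightarrow> 'n multicovector" where
  "weighted \<rho> \<omega> x = \<rho> x (normsq (\<omega> x)) *\<^sub>R \<omega> x"

text \<open>Conditions common to classical solutions of both systems. Densities are only
  required to be positive, so the differentiability of \<open>\<rho>\<omega>\<close> needed to state the equations is
  asked for explicitly; it is automatic for a \<open>C\<^sup>1\<close> density.\<close>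

definition classical_form ::
  "nat \<Rightarrow> (('n::{finite,linorder}) point) set \<Rightarrow> real set \<Rightarrow> ('n point \<Rightarrow> real \<Rightarrow> real) \<Rightarrow>
   'n form \<Rightarrow> bool" where
  "classical_form k \<Omega> I \<rho> \<omega> \<longleftrightarrow> k_form k \<Omega> \<omega> \<and> Ck_on 1 \<Omega> \<omega> \<and> Ck_on 1 \<Omega> (weighted \<rho> \<omega>) \<and>
     (\<forall>x\<in>\<Omega>. normsq (\<omega> x) \<in> I)"

definition frobenius_solution ::
  "nat \<Rightarrow> (('n::{finite,linorder}) point) set \<Rightarrow> real set \<Rightarrow> (real \<Rightarrow> real) \<Rightarrow> (real \<Rightarrow> real) \<Rightarrow> ('n point \<Rightarrow> real \<Rightarrow> real) \<Rightarrow>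
   'n form \<Rightarrow> bool" where
  "frobenius_solution k \<Omega> I \<eta> \<zeta> \<rho> \<omega> \<longleftrightarrow> classical_form k \<Omega> I \<rho> \<omega> \<and>
     (let \<sigma> = ext_deriv (\<lambda>y. form0 (\<zeta> (normsq (\<omega> y))));
          \<gamma> = ext_deriv (\<lambda>y. form0 (\<eta> (normsq (\<omega> y))))
      in \<forall>x\<in>\<Omega>. ext_deriv (\<lambda>y. hodge (weighted \<rho> \<omega> y)) x = \<sigma> x \<and>\<^sub>f hodge (weighted \<rho> \<omega> x) \<and>
               ext_deriv \<omega> x = \<gamma> x \<and>\<^sub>f \<omega> x)"

definition hodge_solution ::
  "nat \<Rightarrow> (('n::{finite,linorder}) point) set \<Rightarrow> real set \<Rightarrow> ('n point \<Rightarrow> real \<Rightarrow> real) \<Rightarrow>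
   'n form \<Rightarrow> bool" where
  "hodge_solution k \<Omega> J \<rho> \<omega> \<longleftrightarrow> classical_form k \<Omega> J \<rho> \<omega> \<and>
     (\<forall>x\<in>\<Omega>. codiff k (weighted \<rho> \<omega>) x = 0 \<and> ext_deriv \<omega> x = 0)"

definition conformally_related ::
  "(('n::{finite,linorder}) point) set \<Rightarrow> 'n form \<Rightarrow> 'n form \<Rightarrow> bool" where
  "conformally_related \<Omega> \<omega> \<omega>' \<longleftrightarrow>
     (\<exists>c :: 'n point \<Rightarrow> real. Ck_on 1 \<Omega> c \<and> (\<forall>x\<in>\<Omega>. 0 < c x \<and> \<omega>' x = c x *\<^sub>R \<omega> x))"

definition f_eta :: "(real \<Rightarrow> real) \<Rightarrow> real \<Rightarrow> real" where
  "f_eta \<eta> t = t * exp (- 2 * \<eta> t)"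

definition phi :: "(('n::{finite,linorder}) point \<Rightarrow> real \<Rightarrow> real) \<Rightarrow> 'n point \<Rightarrow> real \<Rightarrow> real" where
  "phi \<rho> x t = t * (\<rho> x t)\<^sup>2"

text \<open>\<open>0 < \<rho>\<^sup>2 + 2Q\<rho>'\<rho>\<close> at the point \<open>(x, Q)\<close>; \<open>J\<close> is the range of \<open>Q\<close>, so that derivatives at
  end points of \<open>J\<close> are one-sided.\<close>

definition elliptic_at :: "real set \<Rightarrow> (('n::{finite,linorder}) point \<Rightarrow> real \<Rightarrow> real) \<Rightarrow> 'n point \<Rightarrow> real \<Rightarrow> bool" where
  "elliptic_at J \<rho> x Q \<longleftrightarrow>
     (\<exists>\<rho>'. (\<rho> x has_real_derivative \<rho>') (at Q within J) \<and> 0 < (\<rho> x Q)\<^sup>2 + 2 * Q * \<rho>' * \<rho> x Q)"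

definition same_sign :: "real \<Rightarrow> real \<Rightarrow> bool" where
  "same_sign a b \<longleftrightarrow> (0 < a \<and> 0 < b) \<or> (a < 0 \<and> b < 0)"

end

theory Submission
  imports Defs
begin

text \<open>Put \<open>\<omega>\<^sub>1 = exp(\<eta>(|\<omega>\<^sub>1|\<^sup>2)) \<omega>\<^sub>0\<close> and match the densities by
  \<open>\<rho>\<^sub>0(x, f\<^sub>\<eta>(t)) = \<rho>\<^sub>1(x, t) exp(\<eta>(t) - \<zeta>(t))\<close>. Then \<open>|\<omega>\<^sub>0|\<^sup>2 = f\<^sub>\<eta>(|\<omega>\<^sub>1|\<^sup>2)\<close> and
  \<open>\<rho>\<^sub>1\<omega>\<^sub>1 = exp(\<zeta>(|\<omega>\<^sub>1|\<^sup>2)) \<rho>\<^sub>0\<omega>\<^sub>0\<close>. Since \<open>d(exp(a) \<alpha>) = exp(a) (da \<and> \<alpha> + d\<alpha>)\<close>, the integrating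
  factors \<open>exp(\<eta>)\<close> and \<open>exp(\<zeta>)\<close> turn each equation of one system into one of the other.
  Ellipticity follows from \<open>\<phi>\<^bsub>\<rho>\<^sub>0\<^esub>(x, s) = \<phi>\<^bsub>\<rho>\<^sub>1 exp(-\<zeta>)\<^esub>(x, g(s))\<close> and the chain rule.\<close>

section \<open>Functions of class C^1\<close>

lemma Ck_on_1_iff:
  "Ck_on 1 S f \<longleftrightarrow>
     (\<forall>x\<in>S. f differentiable (at x)) \<and>
     (\<forall>v. continuous_on S (\<lambda>x. frechet_derivative f (at x) v))"
  by simp

lemma Ck_on_1I:
  assumes "\<And>x. x \<in> S \<Longrightarrow> (f has_derivative f' x) (at x)"
    and "\<And>v. continuous_on S (\<lambda>x. f' x v)"
  shows "Ck_on 1 S f"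
  unfolding Ck_on_1_iff
proof (intro conjI ballI allI)
  show "f differentiable (at x)" if "x \<in> S" for x
    using assms(1)[OF that] by (rule differentiableI)
  show "continuous_on S (\<lambda>x. frechet_derivative f (at x) v)" for v
    using assms(2)[of v] assms(1) frechet_derivative_at
    by (metis (mono_tags, lifting) continuous_on_cong)
qed

lemma Ck_on_1_has_derivative:
  assumes "Ck_on 1 S f" "x \<in> S"
  shows "(f has_derivative frechet_derivative f (at x)) (at x)"
  using assms frechet_derivative_works Ck_on_1_iff by blast

lemma Ck_on_1_continuous_on: "Ck_on 1 S f \<Longrightarrow> continuous_on S f"
  by (meson Ck_on_1_has_derivative continuous_at_imp_continuous_on has_derivative_continuous)

text \<open>Forms are total functions constrained only on the domain. Openness makes derivatives at
  its points independent of values elsewhere; the next two lemmas draw the consequences.\<close>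

lemma has_derivative_cong_open:
  assumes "open S" "\<And>x. x \<in> S \<Longrightarrow> f x = h x" "x \<in> S"
  shows "(f has_derivative D) (at x) \<longleftrightarrow> (h has_derivative D) (at x)"
  using assms has_derivative_transform_within_open by metis

lemma frechet_derivative_cong_open:
  assumes "open S" "\<And>x. x \<in> S \<Longrightarrow> f x = h x" "x \<in> S"
  shows "frechet_derivative f (at x) = frechet_derivative h (at x)"
  unfolding frechet_derivative_def using has_derivative_cong_open[OF assms] by simp

lemma Ck_on_1_cong:
  assumes "open S" "\<And>x. x \<in> S \<Longrightarrow> f x = h x"
  shows "Ck_on 1 S f \<longleftrightarrow> Ck_on 1 S h"
proof -
  have "continuous_on S (\<lambda>x. frechet_derivative f (at x) v) \<longleftrightarrow>
        continuous_on S (\<lambda>x. frechet_derivative h (at x) v)" for v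
    using frechet_derivative_cong_open[OF assms] by (intro continuous_on_cong) auto
  moreover have "f differentiable (at x) \<longleftrightarrow> h differentiable (at x)" if "x \<in> S" for x
    unfolding differentiable_def using has_derivative_cong_open[OF assms that] by simp
  ultimately show ?thesis
    unfolding Ck_on_1_iff by simp
qed

text \<open>A single Leibniz argument serves both scalar multiples of forms and, through the inner
  product, \<open>normsq\<close>.\<close>

lemma Ck_on_1_bilinear:
  assumes "bounded_bilinear m" "Ck_on 1 S f" "Ck_on 1 S h"
  shows "Ck_on 1 S (\<lambda>x. m (f x) (h x))"
proof (rule Ck_on_1I)
  show "((\<lambda>x. m (f x) (h x)) has_derivative
      (\<lambda>v. m (f x) (frechet_derivative h (at x) v) + m (frechet_derivative f (at x) v) (h x)))
      (at x)" if "x \<in> S" for x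
    using that assms by (intro bounded_bilinear.FDERIV Ck_on_1_has_derivative)
  show "continuous_on S (\<lambda>x. m (f x) (frechet_derivative h (at x) v) +
      m (frechet_derivative f (at x) v) (h x))" for v
    using assms(2,3) Ck_on_1_continuous_on[OF assms(2)] Ck_on_1_continuous_on[OF assms(3)]
    unfolding Ck_on_1_iff
    by (intro continuous_on_add bounded_bilinear.continuous_on[OF assms(1)]) auto
qed

lemmas Ck_on_1_scaleR = Ck_on_1_bilinear[OF bounded_bilinear_scaleR]
lemmas Ck_on_1_inner = Ck_on_1_bilinear[OF bounded_bilinear_inner]

text \<open>The one-sided derivatives at end points of \<open>I\<close> suffice because \<open>q\<close> maps the open set \<open>S\<close>
  into \<open>I\<close>.\<close>

lemma Ck_on_1_C1_compose:
  fixes q :: "'a::real_normed_vector \<Rightarrow> real"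
  assumes "open S" "C1_on_interval I h" "Ck_on 1 S q" "q ` S \<subseteq> I"
  shows "Ck_on 1 S (\<lambda>x. h (q x))"
proof -
  obtain h' where h': "continuous_on I h'"
    "\<And>t. t \<in> I \<Longrightarrow> (h has_real_derivative h' t) (at t within I)"
    using assms(2) unfolding C1_on_interval_def by blast
  show ?thesis
  proof (rule Ck_on_1I)
    show "((\<lambda>x. h (q x)) has_derivative (\<lambda>v. h' (q x) * frechet_derivative q (at x) v)) (at x)"
      if x: "x \<in> S" for x
    proof -
      have "(q has_derivative frechet_derivative q (at x)) (at x within S)"
        using Ck_on_1_has_derivative[OF assms(3) x] has_derivative_at_withinI by blast
      moreover have "(h has_derivative (*) (h' (q x))) (at (q x) within q ` S)"
        using h'(2)[of "q x"] x assms(4) unfolding has_field_derivative_def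
        by (meson has_derivative_subset image_subset_iff)
      ultimately show ?thesis
        using has_derivative_in_compose at_within_open[OF x assms(1)] by metis
    qed
    show "continuous_on S (\<lambda>x. h' (q x) * frechet_derivative q (at x) v)" for v
      using assms(3) continuous_on_compose2[OF h'(1) Ck_on_1_continuous_on[OF assms(3)] assms(4)]
      unfolding Ck_on_1_iff by (intro continuous_on_mult) auto
  qed
qed

lemma C1_on_interval_exp: "C1_on_interval I (\<lambda>t. exp (c * t))"
  unfolding C1_on_interval_def
  by (intro exI[of _ "\<lambda>t. c * exp (c * t)"] conjI ballI continuous_intros)
    (auto intro!: derivative_eq_intros)

text \<open>The constant \<open>c\<close> covers an integrating factor (\<open>c = 1\<close>) and
  its reciprocal (\<open>c = -1\<close>) at once.\<close>

lemma Ck_on_1_exp: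
  fixes a :: "'a::real_normed_vector \<Rightarrow> real"
  assumes "open S" "Ck_on 1 S a"
  shows "Ck_on 1 S (\<lambda>x. exp (c * a x))"
  using Ck_on_1_C1_compose[OF assms(1) C1_on_interval_exp[of UNIV c] assms(2)] by simp

lemma C1_on_interval_continuous_on: "C1_on_interval I h \<Longrightarrow> continuous_on I h"
  unfolding C1_on_interval_def continuous_on_eq_continuous_within
  using DERIV_continuous by blast

section \<open>Forms\<close>

lemma shuffle_sign_empty [simp]: "shuffle_sign K {} = 1"
  by (simp add: shuffle_sign_def)

lemma shuffle_sign_square [simp]: "shuffle_sign I J * shuffle_sign I J = 1"
  by (simp add: shuffle_sign_def flip: power_mult_distrib)

lemma bounded_bilinear_wedge: "bounded_bilinear (\<and>\<^sub>f)"
proof -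
  have "bilinear ((\<and>\<^sub>f) :: 'a::{finite,linorder} multicovector \<Rightarrow> _)"
    unfolding bilinear_def
    by (intro conjI allI linearI)
      (auto simp: wedge_def vec_eq_iff algebra_simps sum.distrib sum_distrib_left)
  then show ?thesis
    by (rule bilinear_conv_bounded_bilinear[THEN iffD1])
qed

interpretation wedge: bounded_bilinear "(\<and>\<^sub>f)"
  by (rule bounded_bilinear_wedge)

text \<open>A 0-form has only its coordinate at \<open>{}\<close>, so the term \<open>I = K\<close>
  alone survives, with sign 1. The 0-form stands on the right because \<open>ext_deriv\<close> puts
  the coordinate covectors on the left.\<close>

lemma wedge_form0: "a \<and>\<^sub>f form0 c = c *\<^sub>R a"
proof -
  have "(\<Sum>I\<in>Pow K. shuffle_sign I (K - I) * a $ I * axis {} c $ (K - I)) = c * a $ K" for K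
  proof -
    have "(\<Sum>I\<in>Pow K. shuffle_sign I (K - I) * a $ I * axis {} c $ (K - I)) =
        (\<Sum>I\<in>Pow K. if I = K then c * a $ K else 0)"
      by (intro sum.cong) (auto simp: axis_def)
    then show ?thesis
      by simp
  qed
  then show ?thesis
    by (simp add: wedge_def form0_def vec_eq_iff)
qed

lemma linear_hodge: "linear hodge"
  by (rule linearI) (auto simp: hodge_def vec_eq_iff algebra_simps)

text \<open>The star permutes coordinates by complementation, up to nonzero signs. This removes the
  outer star of \<open>codiff\<close>.\<close>

lemma hodge_eq_0_iff: "hodge a = 0 \<longleftrightarrow> a = 0"
proof
  assume "hodge a = 0"
  then have "shuffle_sign (- K) K * a $ (- K) = 0" for K
    unfolding hodge_def vec_eq_iff by simp
  moreover have "shuffle_sign (- K) K \<noteq> 0" for K :: "'a set"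
    by (simp add: shuffle_sign_def)
  ultimately have "a $ (- K) = 0" for K
    by (metis mult_eq_0_iff)
  then have "a $ K = 0" for K
    by (metis double_compl)
  then show "a = 0"
    by (simp add: vec_eq_iff)
qed (simp add: linear_0[OF linear_hodge])

text \<open>The wedge and the inner star contribute the same sign
  \<open>shuffle_sign I (- I)\<close>, which squares to 1; the outer star contributes
  \<open>shuffle_sign UNIV {} = 1\<close>.\<close>

lemma normsq_eq_inner: "normsq a = a \<bullet> a"
proof -
  have "normsq a = (\<Sum>I\<in>UNIV. shuffle_sign I (- I) * a $ I * (shuffle_sign I (- I) * a $ I))"
    unfolding normsq_def by (simp add: hodge_def wedge_def Compl_eq_Diff_UNIV[symmetric])
  also have "\<dots> = (\<Sum>I\<in>UNIV. (shuffle_sign I (- I) * shuffle_sign I (- I)) * (a $ I * a $ I))"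
    by (intro sum.cong) (auto simp: ac_simps)
  also have "\<dots> = a \<bullet> a"
    by (simp add: inner_vec_def)
  finally show ?thesis .
qed

text \<open>With \<open>c = - \<eta> t\<close> and \<open>normsq a = t\<close> the right-hand side
  is \<open>f_eta \<eta> t\<close>.\<close>

lemma normsq_exp_scaleR: "normsq (exp c *\<^sub>R a) = exp (2 * c) * normsq a"
  unfolding normsq_eq_inner mult_2 exp_add by simp

lemma ext_deriv_eq:
  assumes "(\<omega> has_derivative D) (at x)"
  shows "ext_deriv \<omega> x = (\<Sum>i\<in>UNIV. axis {i} 1 \<and>\<^sub>f D (axis i 1))"
  unfolding ext_deriv_def using frechet_derivative_at[OF assms] by simp

lemma ext_deriv_cong_open:
  assumes "open S" "\<And>y. y \<in> S \<Longrightarrow> \<omega> y = \<omega>' y" "x \<in> S"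
  shows "ext_deriv \<omega> x = ext_deriv \<omega>' x"
  using frechet_derivative_cong_open[of S \<omega> \<omega>' x] assms by (simp add: ext_deriv_def)

lemma ext_deriv_form0:
  fixes a :: "('n::{finite,linorder}) point \<Rightarrow> real"
  assumes "(a has_derivative D) (at x)"
  shows "ext_deriv (\<lambda>y. form0 (a y)) x = (\<Sum>i\<in>UNIV. D (axis i 1) *\<^sub>R axis {i} 1)"
proof -
  have form0: "form0 c = c *\<^sub>R (axis {} 1 :: 'n multicovector)" for c
    by (simp add: form0_def vec_eq_iff axis_def)
  have "((\<lambda>y. form0 (a y) :: 'n multicovector) has_derivative (\<lambda>v. form0 (D v))) (at x)"
    unfolding form0 by (intro has_derivative_scaleR_left assms)
  from ext_deriv_eq[OF this] show ?thesis
    by (simp add: wedge_form0)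
qed

text \<open>By Leibniz the derivative in direction \<open>v\<close> is \<open>exp (a x)\<close>
  times \<open>A v *\<^sub>R \<omega> x + W v\<close>. Bilinearity moves each scalar
  \<open>A (axis i 1)\<close> onto the covector \<open>axis {i} 1\<close>, and the sum over
  \<open>i\<close> rebuilds the differential of \<open>a\<close>.\<close>

lemma ext_deriv_exp_scaleR:
  assumes "a differentiable (at x)" "\<omega> differentiable (at x)"
  shows "ext_deriv (\<lambda>y. exp (a y) *\<^sub>R \<omega> y) x =
    exp (a x) *\<^sub>R (ext_deriv (\<lambda>y. form0 (a y)) x \<and>\<^sub>f \<omega> x + ext_deriv \<omega> x)"
proof -
  obtain A W where A: "(a has_derivative A) (at x)" and W: "(\<omega> has_derivative W) (at x)"
    using assms unfolding differentiable_def by blast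
  have "((\<lambda>y. exp (a y) *\<^sub>R \<omega> y) has_derivative
      (\<lambda>v. exp (a x) *\<^sub>R (A v *\<^sub>R \<omega> x + W v))) (at x)"
    by (rule has_derivative_eq_rhs[OF has_derivative_scaleR[OF has_derivative_exp[OF A] W]])
      (auto simp: algebra_simps)
  from ext_deriv_eq[OF this] show ?thesis
    by (simp add: ext_deriv_eq[OF W] ext_deriv_form0[OF A] wedge.add_right wedge.scaleR_right
        wedge.scaleR_left wedge.sum_left scaleR_sum_right sum.distrib scaleR_right_distrib)
qed

text \<open>The Leibniz formula leaves \<open>exp (a x) *\<^sub>R ext_deriv \<omega> x\<close> as
  the difference of the two sides, and the exponential never vanishes. The form is arbitrary, so
  both equations of the system are instances.\<close>

lemma integrating_factor:
  assumes "open S" "x \<in> S" "a differentiable (at x)" "\<omega> differentiable (at x)"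
    and \<omega>': "\<And>y. y \<in> S \<Longrightarrow> \<omega>' y = exp (a y) *\<^sub>R \<omega> y"
  shows "ext_deriv \<omega>' x = ext_deriv (\<lambda>y. form0 (a y)) x \<and>\<^sub>f \<omega>' x \<longleftrightarrow> ext_deriv \<omega> x = 0"
  using ext_deriv_exp_scaleR[OF assms(3,4)] ext_deriv_cong_open[of S \<omega>' "\<lambda>y. exp (a y) *\<^sub>R \<omega> y" x] assms(1,2) \<omega>'
  by (simp add: \<omega>'[OF assms(2)] wedge.scaleR_right scaleR_right_distrib)

lemma codiff_eq_0_iff: "codiff k \<omega> x = 0 \<longleftrightarrow> ext_deriv (\<lambda>y. hodge (\<omega> y)) x = 0"
  by (simp add: codiff_def hodge_eq_0_iff)

section \<open>The correspondence\<close>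

text \<open>Both directions of the theorem reduce to this equivalence once the missing form is
  constructed. The regularity of \<open>\<eta>\<close> and \<open>\<zeta>\<close> along
  \<open>\<omega>\<^sub>1\<close> is assumed because the two directions obtain it
  differently.\<close>

lemma frobenius_iff_hodge:
  fixes \<Omega> :: "('n::{finite,linorder}) point set"
  assumes \<Omega>: "open \<Omega>"
    and \<omega>: "\<And>x. x \<in> \<Omega> \<Longrightarrow> \<omega>\<^sub>1 x = exp (\<eta> (normsq (\<omega>\<^sub>1 x))) *\<^sub>R \<omega>\<^sub>0 x"
    and I: "\<And>x. x \<in> \<Omega> \<Longrightarrow> normsq (\<omega>\<^sub>1 x) \<in> I"
    and \<eta>: "Ck_on 1 \<Omega> (\<lambda>x. \<eta> (normsq (\<omega>\<^sub>1 x)))"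
    and \<zeta>: "Ck_on 1 \<Omega> (\<lambda>x. \<zeta> (normsq (\<omega>\<^sub>1 x)))"
    and J: "f_eta \<eta> ` I \<subseteq> J"
    and \<rho>: "\<And>x t. x \<in> \<Omega> \<Longrightarrow> t \<in> I \<Longrightarrow> \<rho>\<^sub>0 x (f_eta \<eta> t) = \<rho>\<^sub>1 x t * exp (\<eta> t - \<zeta> t)"
  shows "frobenius_solution k \<Omega> I \<eta> \<zeta> \<rho>\<^sub>1 \<omega>\<^sub>1 \<longleftrightarrow> hodge_solution k \<Omega> J \<rho>\<^sub>0 \<omega>\<^sub>0"
proof -
  let ?a = "\<lambda>x. \<eta> (normsq (\<omega>\<^sub>1 x))" and ?b = "\<lambda>x. \<zeta> (normsq (\<omega>\<^sub>1 x))"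
  have \<omega>0: "\<omega>\<^sub>0 x = exp (- ?a x) *\<^sub>R \<omega>\<^sub>1 x" if "x \<in> \<Omega>" for x
    using \<omega>[OF that] by (metis exp_minus_inverse mult.commute scaleR_one scaleR_scaleR)
  have normsq: "normsq (\<omega>\<^sub>0 x) = f_eta \<eta> (normsq (\<omega>\<^sub>1 x))" if "x \<in> \<Omega>" for x
    using normsq_exp_scaleR[of "- ?a x" "\<omega>\<^sub>1 x"] \<omega>0[OF that]
    by (simp add: f_eta_def mult.commute)
  \<comment> \<open>The density contributes \<open>exp (\<eta> - \<zeta>)\<close> and the form
    \<open>exp (- \<eta>)\<close>, so only \<open>exp (- \<zeta>)\<close> remains.\<close>
  have w0: "weighted \<rho>\<^sub>0 \<omega>\<^sub>0 x = exp (- ?b x) *\<^sub>R weighted \<rho>\<^sub>1 \<omega>\<^sub>1 x" if "x \<in> \<Omega>" for x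
    unfolding weighted_def normsq[OF that] \<rho>[OF that I[OF that]]
    by (subst \<omega>0[OF that]) (simp add: exp_diff exp_minus field_simps)
  have w1: "weighted \<rho>\<^sub>1 \<omega>\<^sub>1 x = exp (?b x) *\<^sub>R weighted \<rho>\<^sub>0 \<omega>\<^sub>0 x" if "x \<in> \<Omega>" for x
    unfolding w0[OF that] by (simp add: exp_minus)
  \<comment> \<open>Used with \<open>c = 1\<close> and \<open>c = -1\<close> to carry regularity
    both ways, for the forms and for the weighted forms.\<close>
  have Ck: "Ck_on 1 \<Omega> \<alpha>"
    if "Ck_on 1 \<Omega> a" "Ck_on 1 \<Omega> \<beta>" "\<And>x. x \<in> \<Omega> \<Longrightarrow> \<alpha> x = exp (c * a x) *\<^sub>R \<beta> x"
    for a c and \<alpha> \<beta> :: "'n form"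
  proof -
    have "Ck_on 1 \<Omega> (\<lambda>x. exp (c * a x) *\<^sub>R \<beta> x)"
      by (intro Ck_on_1_scaleR Ck_on_1_exp \<Omega> that(1,2))
    then show ?thesis
      using Ck_on_1_cong[OF \<Omega>, of \<alpha> "\<lambda>x. exp (c * a x) *\<^sub>R \<beta> x"] that(3) by blast
  qed
  have classical: "classical_form k \<Omega> I \<rho>\<^sub>1 \<omega>\<^sub>1 \<longleftrightarrow> classical_form k \<Omega> J \<rho>\<^sub>0 \<omega>\<^sub>0"
  proof -
    have "k_form k \<Omega> \<omega>\<^sub>1 \<longleftrightarrow> k_form k \<Omega> \<omega>\<^sub>0"
      unfolding k_form_def using \<omega> \<omega>0 by (metis mult_zero_right vector_scaleR_component real_scaleR_def)
    moreover have "Ck_on 1 \<Omega> \<omega>\<^sub>1 \<longleftrightarrow> Ck_on 1 \<Omega> \<omega>\<^sub>0"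
      using Ck[OF \<eta>, of \<omega>\<^sub>0 \<omega>\<^sub>1 1] Ck[OF \<eta>, of \<omega>\<^sub>1 \<omega>\<^sub>0 "-1"] \<omega> \<omega>0
      unfolding mult_1 mult_minus1 by blast
    moreover have "Ck_on 1 \<Omega> (weighted \<rho>\<^sub>1 \<omega>\<^sub>1) \<longleftrightarrow> Ck_on 1 \<Omega> (weighted \<rho>\<^sub>0 \<omega>\<^sub>0)"
      using Ck[OF \<zeta>, of "weighted \<rho>\<^sub>0 \<omega>\<^sub>0" "weighted \<rho>\<^sub>1 \<omega>\<^sub>1" 1]
        Ck[OF \<zeta>, of "weighted \<rho>\<^sub>1 \<omega>\<^sub>1" "weighted \<rho>\<^sub>0 \<omega>\<^sub>0" "-1"] w1 w0
      unfolding mult_1 mult_minus1 by blast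
    moreover have "\<forall>x\<in>\<Omega>. normsq (\<omega>\<^sub>0 x) \<in> J"
      using normsq I J by auto
    ultimately show ?thesis
      unfolding classical_form_def using I by blast
  qed
  \<comment> \<open>The equations are compared only for classical forms, since the Leibniz rule
    needs differentiability; \<open>classical\<close> makes that assumption common to both
    sides.\<close>
  have "ext_deriv (\<lambda>y. hodge (weighted \<rho>\<^sub>1 \<omega>\<^sub>1 y)) x =
          ext_deriv (\<lambda>y. form0 (?b y)) x \<and>\<^sub>f hodge (weighted \<rho>\<^sub>1 \<omega>\<^sub>1 x) \<longleftrightarrow>
        codiff k (weighted \<rho>\<^sub>0 \<omega>\<^sub>0) x = 0"
    and "ext_deriv \<omega>\<^sub>1 x = ext_deriv (\<lambda>y. form0 (?a y)) x \<and>\<^sub>f \<omega>\<^sub>1 x \<longleftrightarrow> ext_deriv \<omega>\<^sub>0 x = 0"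
    if "classical_form k \<Omega> J \<rho>\<^sub>0 \<omega>\<^sub>0" and x: "x \<in> \<Omega>" for x
  proof -
    have diff: "\<omega>\<^sub>0 differentiable (at x)" "weighted \<rho>\<^sub>0 \<omega>\<^sub>0 differentiable (at x)"
      "?a differentiable (at x)" "?b differentiable (at x)"
      using that \<eta> \<zeta> unfolding classical_form_def Ck_on_1_iff by auto
    have "(\<lambda>y. hodge (weighted \<rho>\<^sub>0 \<omega>\<^sub>0 y)) differentiable (at x)"
      using diff(2) linear_hodge bounded_linear.has_derivative linear_conv_bounded_linear
      unfolding differentiable_def by blast
    then show "ext_deriv (\<lambda>y. hodge (weighted \<rho>\<^sub>1 \<omega>\<^sub>1 y)) x =
          ext_deriv (\<lambda>y. form0 (?b y)) x \<and>\<^sub>f hodge (weighted \<rho>\<^sub>1 \<omega>\<^sub>1 x) \<longleftrightarrow>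
        codiff k (weighted \<rho>\<^sub>0 \<omega>\<^sub>0) x = 0"
      \<comment> \<open>By linearity the star commutes with the scalar \<open>exp (\<zeta>)\<close>,
        so the starred weighted forms are related by the same factor.\<close>
      unfolding codiff_eq_0_iff
      by (intro integrating_factor[OF \<Omega> x diff(4)]) (simp_all add: w1 linear_cmul[OF linear_hodge])
    show "ext_deriv \<omega>\<^sub>1 x = ext_deriv (\<lambda>y. form0 (?a y)) x \<and>\<^sub>f \<omega>\<^sub>1 x \<longleftrightarrow> ext_deriv \<omega>\<^sub>0 x = 0"
      by (rule integrating_factor[OF \<Omega> x diff(3,1) \<omega>])
  qed
  then show ?thesis
    unfolding frobenius_solution_def hodge_solution_def Let_def classical by blast
qed

lemma Ck_on_1_normsq: "Ck_on 1 S \<omega> \<Longrightarrow> Ck_on 1 S (\<lambda>x. normsq (\<omega> x))"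
  unfolding normsq_eq_inner by (intro Ck_on_1_inner)

lemma conformally_related_exp:
  assumes "open \<Omega>" "Ck_on 1 \<Omega> a" "\<And>x. x \<in> \<Omega> \<Longrightarrow> \<omega>' x = exp (c * a x) *\<^sub>R \<omega> x"
  shows "conformally_related \<Omega> \<omega> \<omega>'"
  unfolding conformally_related_def using Ck_on_1_exp[OF assms(1,2), of c] assms(3) by auto

text \<open>The ellipticity expression is the derivative of \<open>phi \<rho> x\<close> by the
  product rule. At a limit point of \<open>J\<close> derivatives within \<open>J\<close> are unique,
  so the existential in \<open>elliptic_at\<close> has one candidate and \<open>p\<close> may be
  computed in any other way.\<close>

lemma elliptic_at_iff_phi:
  assumes "(\<rho> x has_real_derivative r) (at s within J)" "s islimpt J"
    and "(phi \<rho> x has_real_derivative p) (at s within J)"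
  shows "elliptic_at J \<rho> x s \<longleftrightarrow> 0 < p"
proof -
  have unique: "D = E" if "(h has_real_derivative D) (at s within J)"
    "(h has_real_derivative E) (at s within J)" for h D E
    using that vector_derivative_unique_within[of s J h D E] assms(2)
    by (simp add: has_real_derivative_iff_has_vector_derivative trivial_limit_within)
  have "(phi \<rho> x has_real_derivative (\<rho> x s)\<^sup>2 + 2 * s * r * \<rho> x s) (at s within J)"
    unfolding phi_def by (rule derivative_eq_intros assms(1) refl | simp)+
  then have "p = (\<rho> x s)\<^sup>2 + 2 * s * r * \<rho> x s"
    using unique assms(3) by blast
  then show ?thesis
    unfolding elliptic_at_def using unique assms(1) by blast
qed

text \<open>A connected set with two points has no isolated point. This makes one-sided derivatives
  at end points unique as well.\<close>

lemma is_interval_islimpt: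
  fixes I :: "real set"
  assumes "is_interval I" "a \<in> I" "b \<in> I" "a \<noteq> b" "t \<in> I"
  shows "t islimpt I"
  using assms connected_imp_perfect[of I t] by (metis is_interval_connected_1 singletonD)


theorem theorem4p3:
  fixes \<Omega> :: "('n::{finite,linorder}) point set" and k :: nat
    and I J :: "real set" and \<eta> \<zeta> g :: "real \<Rightarrow> real"
  assumes "smooth_domain \<Omega>"
    and "is_interval I" and "interior I \<noteq> {}" and "I \<subseteq> {0..}"
    and "C1_on_interval I \<eta>" and "\<eta> ` I \<subseteq> {0..}"
    and "C1_on_interval I \<zeta>" and "\<zeta> ` I \<subseteq> {0..}"
    and "bij_betw (f_eta \<eta>) I J" and "\<And>t. t \<in> I \<Longrightarrow> g (f_eta \<eta> t) = t"
  shows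
    "let corresponding = (\<lambda>(\<rho>\<^sub>1 :: 'n point \<Rightarrow> real \<Rightarrow> real) (\<rho>\<^sub>0 :: 'n point \<Rightarrow> real \<Rightarrow> real).
        (\<forall>\<omega>\<^sub>1. frobenius_solution k \<Omega> I \<eta> \<zeta> \<rho>\<^sub>1 \<omega>\<^sub>1 \<longrightarrow>
           (\<exists>\<omega>\<^sub>0. hodge_solution k \<Omega> J \<rho>\<^sub>0 \<omega>\<^sub>0 \<and> conformally_related \<Omega> \<omega>\<^sub>1 \<omega>\<^sub>0)) \<and>
        (\<forall>x\<in>\<Omega>. \<forall>s\<in>J. g differentiable (at s within J) \<longrightarrow>
           \<rho>\<^sub>1 x differentiable (at (g s) within I) \<longrightarrow>
           (elliptic_at J \<rho>\<^sub>0 x s \<longleftrightarrow>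
            same_sign (vector_derivative g (at s within J))
              (vector_derivative (phi (\<lambda>y t. \<rho>\<^sub>1 y t * exp (- \<zeta> t)) x) (at (g s) within I)))) \<and>
        (C1_on_interval J g \<longrightarrow>
          (\<forall>\<omega>\<^sub>0. hodge_solution k \<Omega> J \<rho>\<^sub>0 \<omega>\<^sub>0 \<longrightarrow>
             (\<exists>\<omega>\<^sub>1. frobenius_solution k \<Omega> I \<eta> \<zeta> \<rho>\<^sub>1 \<omega>\<^sub>1 \<and> conformally_related \<Omega> \<omega>\<^sub>0 \<omega>\<^sub>1))))
     in (\<forall>\<rho>\<^sub>1. mass_density \<Omega> I \<rho>\<^sub>1 \<longrightarrow> (\<exists>\<rho>\<^sub>0. mass_density \<Omega> J \<rho>\<^sub>0 \<and> corresponding \<rho>\<^sub>1 \<rho>\<^sub>0)) \<and>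
        (\<forall>\<rho>\<^sub>0. mass_density \<Omega> J \<rho>\<^sub>0 \<longrightarrow> (\<exists>\<rho>\<^sub>1. mass_density \<Omega> I \<rho>\<^sub>1 \<and> corresponding \<rho>\<^sub>1 \<rho>\<^sub>0))"
proof -

  \<comment> \<open>The intervals \<open>I\<close> and \<open>J\<close> and the inverse
    \<open>g\<close>\<close>
  let ?f = "f_eta \<eta>"
  have \<Omega>: "open \<Omega>"
    using assms(1) by (simp add: smooth_domain_def)
  have fI: "?f ` I = J" and inj: "inj_on ?f I"
    using assms(9) by (auto simp: bij_betw_def)
  have g: "g s \<in> I" "?f (g s) = s" if "s \<in> J" for s
    using that fI assms(10) by auto
  obtain a b where ab: "a \<in> I" "b \<in> I" "a \<noteq> b"
  proof -
    have "infinite (interior I)"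
      using assms(3) by (metis finite_imp_not_open open_interior)
    then show thesis
      using that interior_subset[of I]
      by (metis all_not_in_conv finite.emptyI finite_insert singleton_iff subsetD subsetI
          finite_subset)
  qed
  have limI: "t islimpt I" if "t \<in> I" for t
    using is_interval_islimpt[OF assms(2) ab that] .
  \<comment> \<open>\<open>J\<close> is an interval as the continuous image of one, and injectivity
    of \<open>?f\<close> keeps the images of \<open>a\<close> and \<open>b\<close> distinct.\<close>
  have limJ: "s islimpt J" if "s \<in> J" for s
  proof -
    have "continuous_on I ?f"
      unfolding f_eta_def
      by (intro continuous_intros C1_on_interval_continuous_on[OF assms(5)])
    then have "is_interval J"
      using connected_continuous_image assms(2) fI by (metis is_interval_connected_1)
    then show ?thesis
      using is_interval_islimpt[of J "?f a" "?f b" s] ab inj fI that by (auto simp: inj_on_def)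
  qed
  \<comment> \<open>All three conclusions follow from this relation, which can be solved for either
    density; hence both halves of the theorem share one argument.\<close>
  let ?rel = "\<lambda>(\<rho>\<^sub>1 :: 'n point \<Rightarrow> real \<Rightarrow> real) (\<rho>\<^sub>0 :: 'n point \<Rightarrow> real \<Rightarrow> real).
    \<forall>x\<in>\<Omega>. \<forall>t\<in>I. \<rho>\<^sub>0 x (?f t) = \<rho>\<^sub>1 x t * exp (\<eta> t - \<zeta> t)"

  \<comment> \<open>From Frobenius solutions to Hodge solutions\<close>
  have forward: "\<exists>\<omega>\<^sub>0. hodge_solution k \<Omega> J \<rho>\<^sub>0 \<omega>\<^sub>0 \<and> conformally_related \<Omega> \<omega>\<^sub>1 \<omega>\<^sub>0"
    if \<rho>: "?rel \<rho>\<^sub>1 \<rho>\<^sub>0" and sol: "frobenius_solution k \<Omega> I \<eta> \<zeta> \<rho>\<^sub>1 \<omega>\<^sub>1" for \<rho>\<^sub>1 \<rho>\<^sub>0 \<omega>\<^sub>1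
  proof -
    have \<omega>1: "Ck_on 1 \<Omega> \<omega>\<^sub>1" "\<And>x. x \<in> \<Omega> \<Longrightarrow> normsq (\<omega>\<^sub>1 x) \<in> I"
      using sol by (auto simp: frobenius_solution_def classical_form_def)
    have C1: "Ck_on 1 \<Omega> (\<lambda>x. h (normsq (\<omega>\<^sub>1 x)))" if "C1_on_interval I h" for h
      using Ck_on_1_C1_compose[OF \<Omega> that Ck_on_1_normsq[OF \<omega>1(1)]] \<omega>1(2) by blast
    define \<omega>\<^sub>0 where "\<omega>\<^sub>0 = (\<lambda>x. exp (-1 * \<eta> (normsq (\<omega>\<^sub>1 x))) *\<^sub>R \<omega>\<^sub>1 x)"
    have "hodge_solution k \<Omega> J \<rho>\<^sub>0 \<omega>\<^sub>0"
    proof (rule frobenius_iff_hodge[THEN iffD1, OF \<Omega> _ _ _ _ _ _ sol])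
      show "\<omega>\<^sub>1 x = exp (\<eta> (normsq (\<omega>\<^sub>1 x))) *\<^sub>R \<omega>\<^sub>0 x" for x
        by (simp add: \<omega>\<^sub>0_def exp_minus)
    qed (use \<omega>1 C1 assms(5,7) fI \<rho> in auto)
    moreover have "conformally_related \<Omega> \<omega>\<^sub>1 \<omega>\<^sub>0"
      using conformally_related_exp[OF \<Omega> C1[OF assms(5)], of \<omega>\<^sub>0 "-1"] by (simp add: \<omega>\<^sub>0_def)
    ultimately show ?thesis
      by blast
  qed

  \<comment> \<open>From Hodge solutions to Frobenius solutions\<close>
  have backward: "\<exists>\<omega>\<^sub>1. frobenius_solution k \<Omega> I \<eta> \<zeta> \<rho>\<^sub>1 \<omega>\<^sub>1 \<and> conformally_related \<Omega> \<omega>\<^sub>0 \<omega>\<^sub>1"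
    if \<rho>: "?rel \<rho>\<^sub>1 \<rho>\<^sub>0" and C1g: "C1_on_interval J g"
      and sol: "hodge_solution k \<Omega> J \<rho>\<^sub>0 \<omega>\<^sub>0" for \<rho>\<^sub>1 \<rho>\<^sub>0 \<omega>\<^sub>0
  proof -
    have \<omega>0: "Ck_on 1 \<Omega> \<omega>\<^sub>0" "\<And>x. x \<in> \<Omega> \<Longrightarrow> normsq (\<omega>\<^sub>0 x) \<in> J"
      using sol by (auto simp: hodge_solution_def classical_form_def)
    \<comment> \<open>The factor should be
      \<open>exp (\<eta> (normsq (\<omega>\<^sub>1 x)))\<close>, which refers to the form being
      built. Since \<open>normsq (\<omega>\<^sub>0 x)\<close> must equal
      \<open>?f (normsq (\<omega>\<^sub>1 x))\<close>, applying \<open>g\<close> gives the value in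
      advance.\<close>
    let ?q = "\<lambda>x. g (normsq (\<omega>\<^sub>0 x))"
    have q: "Ck_on 1 \<Omega> ?q" "?q ` \<Omega> \<subseteq> I"
      using Ck_on_1_C1_compose[OF \<Omega> C1g Ck_on_1_normsq[OF \<omega>0(1)]] \<omega>0(2) g by auto
    define \<omega>\<^sub>1 where "\<omega>\<^sub>1 = (\<lambda>x. exp (\<eta> (?q x)) *\<^sub>R \<omega>\<^sub>0 x)"
    \<comment> \<open>This closes the circle: \<open>exp (2 * \<eta>)\<close> undoes the exponential
      in \<open>f_eta\<close>, so the predicted value is the actual one.\<close>
    have normsq: "normsq (\<omega>\<^sub>1 x) = ?q x" if "x \<in> \<Omega>" for x
    proof -
      have "normsq (\<omega>\<^sub>1 x) = exp (2 * \<eta> (?q x)) * ?f (?q x)"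
        unfolding \<omega>\<^sub>1_def normsq_exp_scaleR using g(2)[OF \<omega>0(2)[OF that]] by simp
      also have "\<dots> = ?q x"
        by (simp add: f_eta_def exp_minus field_simps)
      finally show ?thesis .
    qed
    have C1: "Ck_on 1 \<Omega> (\<lambda>x. h (?q x))" "Ck_on 1 \<Omega> (\<lambda>x. h (normsq (\<omega>\<^sub>1 x)))"
      if "C1_on_interval I h" for h
      using Ck_on_1_C1_compose[OF \<Omega> that q]
        Ck_on_1_cong[OF \<Omega>, of "\<lambda>x. h (normsq (\<omega>\<^sub>1 x))" "\<lambda>x. h (?q x)"] normsq by auto
    have "frobenius_solution k \<Omega> I \<eta> \<zeta> \<rho>\<^sub>1 \<omega>\<^sub>1"
    proof (rule frobenius_iff_hodge[THEN iffD2, OF \<Omega> _ _ _ _ _ _ sol])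
      show "\<omega>\<^sub>1 x = exp (\<eta> (normsq (\<omega>\<^sub>1 x))) *\<^sub>R \<omega>\<^sub>0 x" if "x \<in> \<Omega>" for x
        using normsq[OF that] by (simp add: \<omega>\<^sub>1_def)
      show "normsq (\<omega>\<^sub>1 x) \<in> I" if "x \<in> \<Omega>" for x
        using normsq[OF that] q(2) that by auto
    qed (use C1(2) assms(5,7) fI \<rho> in auto)
    moreover have "conformally_related \<Omega> \<omega>\<^sub>0 \<omega>\<^sub>1"
      using conformally_related_exp[OF \<Omega> C1(1)[OF assms(5)], of \<omega>\<^sub>1 1] by (simp add: \<omega>\<^sub>1_def)
    ultimately show ?thesis
      by blast
  qed

  \<comment> \<open>Ellipticity and the sign condition\<close>
  have elliptic: "elliptic_at J \<rho>\<^sub>0 x s \<longleftrightarrow>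
      same_sign (vector_derivative g (at s within J))
        (vector_derivative (phi (\<lambda>y t. \<rho>\<^sub>1 y t * exp (- \<zeta> t)) x) (at (g s) within I))"
    if \<rho>: "?rel \<rho>\<^sub>1 \<rho>\<^sub>0" and x: "x \<in> \<Omega>" and s: "s \<in> J" and diff: "g differentiable (at s within J)"
      "\<rho>\<^sub>1 x differentiable (at (g s) within I)" for \<rho>\<^sub>1 \<rho>\<^sub>0 x s
  proof -
    have gJ: "g ` J = I"
      using g(1) fI assms(10) by force
    let ?\<phi> = "phi (\<lambda>y t. \<rho>\<^sub>1 y t * exp (- \<zeta> t)) x"
    obtain g' where g': "(g has_real_derivative g') (at s within J)"
      using diff(1) real_differentiable_def by blast
    obtain r where r: "(\<rho>\<^sub>1 x has_real_derivative r) (at (g s) within I)"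
      using diff(2) real_differentiable_def by blast
    obtain e where e: "(\<eta> has_real_derivative e) (at (g s) within I)"
      using assms(5) g(1)[OF s] unfolding C1_on_interval_def by blast
    obtain z where z: "(\<zeta> has_real_derivative z) (at (g s) within I)"
      using assms(7) g(1)[OF s] unfolding C1_on_interval_def by blast
    \<comment> \<open>Only the existence of this derivative is needed, so its formula stays
      implicit. The same holds for \<open>m\<close>, which after composition with \<open>g\<close>
      gives the derivative of \<open>\<rho>\<^sub>0 x\<close>.\<close>
    have "\<exists>p. (?\<phi> has_real_derivative p) (at (g s) within I)"
      unfolding phi_def by (rule exI derivative_intros r z)+
    then obtain p where p: "(?\<phi> has_real_derivative p) (at (g s) within I)"
      by blast
    have "\<exists>m. ((\<lambda>t. \<rho>\<^sub>1 x t * exp (\<eta> t - \<zeta> t)) has_real_derivative m) (at (g s) within I)"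
      by (rule exI derivative_intros r z e)+
    then obtain m where m:
      "((\<lambda>t. \<rho>\<^sub>1 x t * exp (\<eta> t - \<zeta> t)) has_real_derivative m) (at (g s) within I)"
      by blast
    have \<rho>0: "\<rho>\<^sub>0 x u = \<rho>\<^sub>1 x (g u) * exp (\<eta> (g u) - \<zeta> (g u))" if "u \<in> J" for u
      using \<rho> x g[OF that] by metis
    have phi: "phi \<rho>\<^sub>0 x u = ?\<phi> (g u)" if "u \<in> J" for u
    proof -
      have "phi \<rho>\<^sub>0 x u = ?f (g u) * (\<rho>\<^sub>0 x u)\<^sup>2"
        by (simp add: phi_def g(2)[OF that])
      \<comment> \<open>The factor \<open>exp (2 * \<eta>)\<close> from the squared density cancels
        \<open>exp (- 2 * \<eta>)\<close> from \<open>f_eta\<close>, leaving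
        \<open>exp (- 2 * \<zeta>)\<close>.\<close>
      also have "\<dots> = ?\<phi> (g u)"
        unfolding \<rho>0[OF that]
        by (simp add: phi_def f_eta_def exp_minus exp_diff exp_double power2_eq_square field_simps)
      finally show ?thesis .
    qed
    \<comment> \<open>Since \<open>g\<close> maps \<open>J\<close> onto \<open>I\<close>, a
      derivative within \<open>I\<close> pulls back to one within \<open>J\<close>, end points
      included.\<close>
    have compose: "(h has_real_derivative d * g') (at s within J)"
      if "(h' has_real_derivative d) (at (g s) within I)" "\<And>u. u \<in> J \<Longrightarrow> h u = h' (g u)" for h h' d
    proof -
      have "((\<lambda>u. h' (g u)) has_real_derivative d * g') (at s within J)"
        using DERIV_image_chain[of h' d g s J g'] that(1) g' gJ by (simp add: o_def)
      then show ?thesis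
        using has_derivative_transform[OF s that(2)] unfolding has_field_derivative_def by simp
    qed
    \<comment> \<open>The chain rule enters twice: \<open>m * g'\<close> is the derivative of
      \<open>\<rho>\<^sub>0 x\<close>, and \<open>p * g'\<close> that of
      \<open>phi \<rho>\<^sub>0 x\<close>. A product is positive exactly when its factors have the
      same strict sign.\<close>
    have "elliptic_at J \<rho>\<^sub>0 x s \<longleftrightarrow> 0 < p * g'"
      by (rule elliptic_at_iff_phi[where ?r = "m * g'", OF compose limJ[OF s] compose])
        (use m p \<rho>0 phi in auto)
    moreover have "vector_derivative g (at s within J) = g'"
      using g' limJ[OF s]
      by (simp add: vector_derivative_within trivial_limit_within
          has_real_derivative_iff_has_vector_derivative)
    moreover have "vector_derivative ?\<phi> (at (g s) within I) = p"
      using p limI[OF g(1)[OF s]]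
      by (simp add: vector_derivative_within trivial_limit_within
          has_real_derivative_iff_has_vector_derivative)
    ultimately show ?thesis
      by (auto simp: same_sign_def zero_less_mult_iff)
  qed

  \<comment> \<open>Matching against the goal binds \<open>?corr\<close> to the function that the
    statement calls \<open>corresponding\<close>.\<close>
  let "Let ?corr _" = ?thesis
  have corr: "?corr \<rho>\<^sub>1 \<rho>\<^sub>0" if "?rel \<rho>\<^sub>1 \<rho>\<^sub>0" for \<rho>\<^sub>1 \<rho>\<^sub>0
    using forward[OF that] backward[OF that] elliptic[OF that] by blast

  \<comment> \<open>Solve \<open>?rel\<close> for \<open>\<rho>\<^sub>0\<close> by putting
    \<open>t = g s\<close>, and below for \<open>\<rho>\<^sub>1\<close> by reversing the exponent.
    Exponential factors preserve positivity.\<close>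
  have to0: "\<exists>\<rho>\<^sub>0. mass_density \<Omega> J \<rho>\<^sub>0 \<and> ?rel \<rho>\<^sub>1 \<rho>\<^sub>0" if "mass_density \<Omega> I \<rho>\<^sub>1" for \<rho>\<^sub>1
    using that g(1) assms(10)
    by (intro exI[of _ "\<lambda>x s. \<rho>\<^sub>1 x (g s) * exp (\<eta> (g s) - \<zeta> (g s))"]) (auto simp: mass_density_def)
  have to1: "\<exists>\<rho>\<^sub>1. mass_density \<Omega> I \<rho>\<^sub>1 \<and> ?rel \<rho>\<^sub>1 \<rho>\<^sub>0" if "mass_density \<Omega> J \<rho>\<^sub>0" for \<rho>\<^sub>0
    using that fI
    by (intro exI[of _ "\<lambda>x t. \<rho>\<^sub>0 x (?f t) * exp (\<zeta> t - \<eta> t)"])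
      (auto simp: mass_density_def mult.assoc simp flip: exp_add)
  show ?thesis
    unfolding Let_def
  proof (intro conjI allI impI)
    fix \<rho>\<^sub>1 :: "'n point \<Rightarrow> real \<Rightarrow> real"
    assume "mass_density \<Omega> I \<rho>\<^sub>1"
    then obtain \<rho>\<^sub>0 where \<rho>: "mass_density \<Omega> J \<rho>\<^sub>0" "?rel \<rho>\<^sub>1 \<rho>\<^sub>0"
      using to0 by blast
    show "\<exists>\<rho>\<^sub>0. mass_density \<Omega> J \<rho>\<^sub>0 \<and> ?corr \<rho>\<^sub>1 \<rho>\<^sub>0"
      by (intro exI[of _ \<rho>\<^sub>0] conjI[OF \<rho>(1) corr[OF \<rho>(2)]])
  next
    fix \<rho>\<^sub>0 :: "'n point \<Rightarrow> real \<Rightarrow> real"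
    assume "mass_density \<Omega> J \<rho>\<^sub>0"
    then obtain \<rho>\<^sub>1 where \<rho>: "mass_density \<Omega> I \<rho>\<^sub>1" "?rel \<rho>\<^sub>1 \<rho>\<^sub>0"
      using to1 by blast
    show "\<exists>\<rho>\<^sub>1. mass_density \<Omega> I \<rho>\<^sub>1 \<and> ?corr \<rho>\<^sub>1 \<rho>\<^sub>0"
      by (intro exI[of _ \<rho>\<^sub>1] conjI[OF \<rho>(1) corr[OF \<rho>(2)]])
  qed
qed

end
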